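(* Let $T(\cdot,t):\mathbb{R}^d\to\mathbb{R}^d$ be the flow map of the homogeneous Landau equation, i.e. $T(V,0)=V$ and $$\frac{d}{dt}T(V,t)=-\int_{\mathbb{R}^d}A\big(T(V,t)-T(V_*,t)\big)\big[\tilde s_t(T(V,t))-\tilde s_t(T(V_*,t))\big]f_0(V_* )\,dV_*,$$ where $f_0$ is the initial density, $\tilde f_t=T(\cdot,t)_\# f_0$ and $\tilde s_t=\nabla\log\tilde f_t$. Assume that the transport map $T(\cdot,t)$ is invertible, i.e. $\det\nabla_V T(V,t)\neq0$. Then the log determinant of its gradient satisfies $$\frac{d}{dt}\log|\det\nabla_V T(V,t)|=-\int_{\mathbb{R}^d}\nabla\cdot\Big[A\big(T(V,t)-T(V_*,t)\big)\big(\tilde s_t(T(V,t))-\tilde s_t(T(V_*,t))\big)\Big]f_0(V_* )\,dV_*.$$ For the particular kernel $A(z)=C_\gamma|z|^{\gamma+2}\Pi(z)$, this becomes $$\frac{d}{dt}\log|\det\nabla_V T(V,t)|=-C_\gamma\int_{\mathbb{R}^d}\Big\{|T(V,t)-T(V_*,t)|^{\gamma+2}\;\nabla\cdot\Big[\Pi\big(T(V,t)-T(V_*,t)\big)\big(\tilde s_t(T(V,t))-\tilde s_t(T(V_*,t))\big)\Big]\Big\}f_0(V_* )\,dV_*.$$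
   Context: $d\ge2$. $A$ is a matrix-valued collision kernel $\mathbb{R}^d\to\mathbb{R}^{d\times d}$. $\Pi(z)=I_d-\frac{z\otimes z}{|z|^2}$ is the projection onto the orthogonal complement of $z\neq 0$, $C_\gamma>0$, and $-d-1\le\gamma\le1$. The symbol $\nabla\cdot$ denotes divergence with respect to the velocity variable $v$ evaluated at $v=T(V,t)$, with $T(V_*,t)$ held fixed; that is, $\nabla\cdot[A(T(V,t)-T(V_*,t))(\tilde s_t(T(V,t))-\tilde s_t(T(V_*,t)))]$ means $\nabla_v\cdot[A(v-v_* )(\tilde s_t(v)-\tilde s_t(v_* ))]$ at $v=T(V,t)$, $v_*=T(V_*,t)$, and likewise with $\Pi$ in place of $A$. The homogeneous Landau equation is $\partial_t\tilde f_t=-\nabla\cdot(\tilde f_t U[\tilde f_t])$ with $U[\tilde f_t](v)=-\int_{\mathbb{R}^d} A(v-v_* )(\nabla\log\tilde f_t(v)-\nabla\log\tilde f_t(v_* ))\tilde f_t(v_* )\,dv_*$ and initial condition $f_0$.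
   Formalization: Regularity is added: A is C^1 away from 0, the score at time t is C^1 on the range of T, the V-gradient of dT/dt is jointly continuous, the flow integrand is integrable, and the v-derivatives of the integrand are locally uniformly integrable with respect to f_0. *)

theory Defs
  imports "HOL-Analysis.Analysis"
begin

definition perp_proj :: "real ^ 'n \<Rightarrow> real ^ 'n ^ 'n" where
  "perp_proj z = mat 1 - (\<chi> i j. z $ i * z $ j / (norm z)\<^sup>2)"

definition divergence :: "(real ^ 'n \<Rightarrow> real ^ 'n) \<Rightarrow> real ^ 'n \<Rightarrow> real" where
  "divergence F v = trace (jacobian F (at v))"

definition gradient :: "(real ^ 'n \<Rightarrow> real) \<Rightarrow> real ^ 'n \<Rightarrow> real ^ 'n" where
  "gradient f v = (\<chi> i. frechet_derivative f (at v) (axis i 1))"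

definition score :: "(real ^ 'n \<Rightarrow> real) \<Rightarrow> real ^ 'n \<Rightarrow> real ^ 'n" where
  "score f = gradient (\<lambda>v. ln (f v))"

definition collision_flux ::
  "(real ^ 'n \<Rightarrow> real ^ 'n ^ 'n) \<Rightarrow> (real ^ 'n \<Rightarrow> real ^ 'n) \<Rightarrow> real ^ 'n \<Rightarrow> real ^ 'n \<Rightarrow> real ^ 'n" where
  "collision_flux A s w v = A (v - w) *v (s v - s w)"

text \<open>The argument order of \<^const>\<open>collision_flux\<close> puts the partner velocity \<open>w\<close> (written
  \<open>v\<^sub>*\<close> in the equation) before \<open>v\<close>, so that \<open>divergence (collision_flux A s w) v\<close> is the
  divergence in \<open>v\<close> with \<open>w\<close> held fixed.\<close>

text \<open>Only meaningful for open \<open>S\<close>, since derivatives are two-sided.\<close>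

definition C1_on :: "'a::real_normed_vector set \<Rightarrow> ('a \<Rightarrow> 'b::real_normed_vector) \<Rightarrow> bool" where
  "C1_on S f \<longleftrightarrow>
     (\<exists>f' :: 'a \<Rightarrow> 'a \<Rightarrow>\<^sub>L 'b. (\<forall>x\<in>S. (f has_derivative blinfun_apply (f' x)) (at x)) \<and>
        continuous_on S f')"

text \<open>Regularity of a flow on \<open>[0, \<tau>]\<close>: \<open>T(\<cdot>,t)\<close> is differentiable, and the mixed derivative
  \<open>\<nabla>\<^sub>V \<partial>\<^sub>t T\<close> exists and is jointly continuous. This is implied by joint \<open>C\<^sup>2\<close> smoothness; the
  existence of \<open>\<partial>\<^sub>t \<nabla>\<^sub>V T\<close> is not part of the definition.\<close>

definition regular_flow :: "real \<Rightarrow> (real ^ 'n \<Rightarrow> real \<Rightarrow> real ^ 'n) \<Rightarrow> bool" where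
  "regular_flow \<tau> T \<longleftrightarrow>
     (\<forall>t\<in>{0..\<tau>}. \<forall>V. (\<lambda>W. T W t) differentiable (at V)) \<and>
     (\<exists>D :: (real ^ 'n) \<times> real \<Rightarrow> (real ^ 'n) \<Rightarrow>\<^sub>L (real ^ 'n).
        continuous_on (UNIV \<times> {0..\<tau>}) D \<and>
        (\<forall>t\<in>{0..\<tau>}. \<forall>V.
           ((\<lambda>W. vector_derivative (T W) (at t within {0..\<tau>}))
              has_derivative blinfun_apply (D (V, t))) (at V)))"

text \<open>Uniform integrability in the sense of probability theory, for a finite measure \<open>M\<close>.\<close>

definition uniformly_integrable :: "'a measure \<Rightarrow> 'i set \<Rightarrow> ('i \<Rightarrow> 'a \<Rightarrow> real) \<Rightarrow> bool" where
  "uniformly_integrable M I X \<longleftrightarrow>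
     (\<forall>i\<in>I. X i \<in> borel_measurable M) \<and>
     (\<forall>\<epsilon>>0. \<exists>K. \<forall>i\<in>I.
        (\<integral>\<^sup>+ x \<in> {x. K < \<bar>X i x\<bar>}. ennreal \<bar>X i x\<bar> \<partial>M) \<le> ennreal \<epsilon>)"

end

theory Submission
  imports Defs
begin

text \<open>
  Since \<open>\<nabla>\<^sub>V \<partial>\<^sub>t T\<close> is continuous, differentiating \<open>T(V,t) = V + \<integral> \<partial>\<^sub>t T\<close> under the time integral shows
  that \<open>\<partial>\<^sub>t \<nabla>\<^sub>V T\<close> exists and equals \<open>\<nabla>\<^sub>V \<partial>\<^sub>t T\<close>. The flow map being a local diffeomorphism, the velocity
  field \<open>u\<close> with \<open>\<partial>\<^sub>t T = u(T)\<close> is differentiable, so \<open>\<partial>\<^sub>t \<nabla>\<^sub>V T = \<nabla>u(T) \<nabla>\<^sub>V T\<close> and Jacobi's formula gives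
  the trace of \<open>\<nabla>u\<close>. It remains to differentiate \<open>u\<close> under the collision integral, where the kernel is
  singular on the diagonal. Only derivatives along coordinate lines matter for the trace; such a line
  is Lebesgue-null, hence avoided by almost every partner, and uniform integrability permits Fubini
  and Vitali's theorem along it.
\<close>

section \<open>Jacobi's formula for the logarithmic derivative of a determinant\<close>

text \<open>A permutation other than \<open>id\<close> moves at least two indices. The product rule
  drops one factor at a time, so around the identity matrix each term of such a permutation keeps a
  vanishing off-diagonal entry, and only the diagonal product contributes.\<close>

lemma has_real_derivative_det_at_mat_1:
  fixes M :: "real \<Rightarrow> real ^ 'n ^ 'n"
  assumes M: "\<And>i j. ((\<lambda>r. M r $ i $ j) has_real_derivative M' $ i $ j) (at t within S)"
    and Mt: "M t = mat 1"
  shows "((\<lambda>r. det (M r)) has_real_derivative trace M') (at t within S)"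
proof -
  define d where "d p = (\<Sum>i\<in>UNIV. M' $ i $ p i * (\<Prod>j\<in>UNIV - {i}. M t $ j $ p j))" for p
  have "((\<lambda>r. \<Prod>i\<in>UNIV. M r $ i $ p i) has_real_derivative d p) (at t within S)" for p
  proof -
    have "((\<lambda>r. \<Prod>i\<in>UNIV. M r $ i $ p i) has_derivative
        (\<lambda>h. \<Sum>i\<in>UNIV. (M' $ i $ p i * h) * (\<Prod>j\<in>UNIV - {i}. M t $ j $ p j))) (at t within S)"
      using M by (intro has_derivative_prod) (simp add: has_field_derivative_def)
    then show ?thesis
      unfolding has_field_derivative_def
      by (rule has_derivative_eq_rhs) (simp add: fun_eq_iff d_def sum_distrib_left mult_ac)
  qed
  then have "((\<lambda>r. det (M r)) has_real_derivative
      (\<Sum>p | p permutes UNIV. of_int (sign p) * d p)) (at t within S)"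
    unfolding det_def by (intro DERIV_sum DERIV_cmult)
  moreover have "(\<Sum>p | p permutes UNIV. of_int (sign p) * d p)
      = (\<Sum>p \<in> {id}. of_int (sign p) * d p)"
  proof (rule sum.mono_neutral_right)
    show "\<forall>p\<in>{p. p permutes UNIV} - {id}. of_int (sign p) * d p = 0"
    proof
      fix p :: "'n \<Rightarrow> 'n" assume "p \<in> {p. p permutes UNIV} - {id}"
      then have p: "inj p" "p \<noteq> id" by (auto simp: permutes_inj)
      \<comment> \<open>If \<open>i\<close> were the only moved index, injectivity would force
        \<open>p i = i\<close>.\<close>
      have moved: "\<exists>j. j \<noteq> i \<and> p j \<noteq> j" for i
      proof (rule ccontr)
        assume "\<not> ?thesis"
        then have "\<And>j. j \<noteq> i \<Longrightarrow> p j = j" by auto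
        with p show False by (metis eq_id_iff injD)
      qed
      have zero: "(\<Prod>j\<in>UNIV - {i}. M t $ j $ p j) = 0" for i
      proof -
        obtain j where "j \<noteq> i" "p j \<noteq> j" using moved by blast
        then show ?thesis by (intro prod_zero bexI[of _ j]) (auto simp: Mt mat_def)
      qed
      show "of_int (sign p) * d p = 0" unfolding d_def zero by simp
    qed
  qed (auto simp: permutes_id)
  moreover have "d id = trace M'"
    by (simp add: d_def trace_def Mt mat_def)
  ultimately show ?thesis by (simp add: sign_id)
qed

text \<open>Right multiplication by the constant inverse \<open>K\<close> of \<open>J t\<close>
  moves the base point to the identity, where the derivative becomes
  \<open>(U ** J t) ** K = U\<close>; multiplicativity of \<open>det\<close> carries the result
  back.\<close>

lemma has_real_derivative_ln_abs_det:
  fixes J :: "real \<Rightarrow> real ^ 'n ^ 'n"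
  assumes J: "\<And>i j. ((\<lambda>r. J r $ i $ j) has_real_derivative (U ** J t) $ i $ j) (at t within S)"
    and nz: "det (J t) \<noteq> 0"
  shows "((\<lambda>r. ln \<bar>det (J r)\<bar>) has_real_derivative trace U) (at t within S)"
proof -
  obtain K where K: "J t ** K = mat 1" "K ** J t = mat 1"
    using nz by (auto simp flip: invertible_det_nz simp: invertible_def)
  have "((\<lambda>r. det (J r ** K)) has_real_derivative trace U) (at t within S)"
  proof (rule has_real_derivative_det_at_mat_1)
    fix i j
    have U: "(U ** J t) ** K = U" using K by (simp flip: matrix_mul_assoc)
    have entry: "(X ** K) $ i $ j = (\<Sum>k\<in>UNIV. X $ i $ k * K $ k $ j)" for X :: "real ^ 'n ^ 'n"
      by (simp add: matrix_matrix_mult_def)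
    have "((\<lambda>r. (J r ** K) $ i $ j) has_real_derivative ((U ** J t) ** K) $ i $ j) (at t within S)"
      unfolding entry by (intro DERIV_sum DERIV_cmult_right J)
    then show "((\<lambda>r. (J r ** K) $ i $ j) has_real_derivative U $ i $ j) (at t within S)"
      by (simp only: U)
  qed (fact K)
  then have "((\<lambda>r. det (J r ** K) * det (J t)) has_real_derivative trace U * det (J t))
      (at t within S)" by (rule DERIV_cmult_right)
  moreover have "det (J r ** K) * det (J t) = det (J r)" for r
    using K by (simp flip: det_mul matrix_mul_assoc)
  ultimately have D: "((\<lambda>r. det (J r)) has_real_derivative trace U * det (J t)) (at t within S)"
    by simp
  \<comment> \<open>\<open>det (J t)\<close> may have either sign, so the derivative is computed on
    the open half-line that contains it.\<close>
  have "((\<lambda>x. ln \<bar>x\<bar>) has_real_derivative 1 / det (J t)) (at (det (J t)))"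
  proof (cases "0 < det (J t)")
    case True
    then have "(ln has_real_derivative 1 / det (J t)) (at (det (J t)))"
      by (auto intro!: derivative_eq_intros)
    then show ?thesis
      by (rule has_field_derivative_transform_within_open[where S = "{0<..}"]) (use True in auto)
  next
    case False
    then have "((\<lambda>x. ln (- x)) has_real_derivative 1 / det (J t)) (at (det (J t)))"
      using nz by (auto intro!: derivative_eq_intros)
    then show ?thesis
      by (rule has_field_derivative_transform_within_open[where S = "{..<0}"]) (use False nz in auto)
  qed
  from DERIV_chain'[OF D this] show ?thesis using nz by simp
qed

section \<open>Exchange of time and space derivatives of the flow\<close>

text \<open>\<open>E\<close> is defined as the identity plus the time integral of \<open>D\<close>.
  In this form continuity in space and differentiability in time both follow from the joint
  continuity of \<open>D\<close>, and the Leibniz rule identifies \<open>E\<close> with the spatial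
  derivative of the flow.\<close>

lemma regular_flow_spatial_derivative:
  assumes reg: "regular_flow \<tau> T" and \<tau>: "0 < \<tau>" and init: "\<And>W. T W 0 = W"
    and ode: "\<And>r W. r \<in> {0..\<tau>} \<Longrightarrow> (T W has_vector_derivative F r W) (at r within {0..\<tau>})"
  obtains D E :: "real \<Rightarrow> real ^ 'n \<Rightarrow> (real ^ 'n) \<Rightarrow>\<^sub>L (real ^ 'n)" where
    "\<And>r W. r \<in> {0..\<tau>} \<Longrightarrow> (F r has_derivative blinfun_apply (D r W)) (at W)"
    "\<And>r W. r \<in> {0..\<tau>} \<Longrightarrow> ((\<lambda>W. T W r) has_derivative blinfun_apply (E r W)) (at W)"
    "\<And>r. r \<in> {0..\<tau>} \<Longrightarrow> continuous_on UNIV (E r)"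
    "\<And>r W. r \<in> {0..\<tau>} \<Longrightarrow> ((\<lambda>r. E r W) has_vector_derivative D r W) (at r within {0..\<tau>})"
proof -
  obtain D :: "(real ^ 'n) \<times> real \<Rightarrow> (real ^ 'n) \<Rightarrow>\<^sub>L (real ^ 'n)"
    where cD: "continuous_on (UNIV \<times> {0..\<tau>}) D"
      and D0: "\<And>r W. r \<in> {0..\<tau>} \<Longrightarrow>
        ((\<lambda>W. vector_derivative (T W) (at r within {0..\<tau>})) has_derivative blinfun_apply (D (W, r))) (at W)"
    using reg unfolding regular_flow_def by blast
  \<comment> \<open>The interval is nondegenerate since \<open>0 < \<tau>\<close>, so the vector
    derivative within it is unique and equals the right-hand side of the equation.\<close>
  have "vector_derivative (T W) (at r within {0..\<tau>}) = F r W" if "r \<in> {0..\<tau>}" for r W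
    using vector_derivative_within_closed_interval[OF \<tau> that ode[OF that]] .
  with D0 have D: "\<And>r W. r \<in> {0..\<tau>} \<Longrightarrow> (F r has_derivative blinfun_apply (D (W, r))) (at W)"
    by simp
  define E where "E r W = id_blinfun + integral {0..r} (\<lambda>q. D (W, q))" for r W
  have TF: "((\<lambda>q. F q W) has_integral T W r - W) {0..r}" if "r \<in> {0..\<tau>}" for r W
  proof -
    have "(T W has_vector_derivative F q W) (at q within {0..r})" if "q \<in> {0..r}" for q
      by (rule has_vector_derivative_within_subset[OF ode]) (use \<open>r \<in> {0..\<tau>}\<close> that in auto)
    from fundamental_theorem_of_calculus[OF _ this] that show ?thesis by (simp add: init)
  qed
  have cD': "continuous_on (UNIV \<times> {0..r}) (\<lambda>(W, q). D (W, q))" if "r \<in> {0..\<tau>}" for r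
    using that by (auto intro: continuous_on_subset[OF cD])
  show thesis
  proof
    show "(F r has_derivative blinfun_apply (D (W, r))) (at W)" if "r \<in> {0..\<tau>}" for r W
      using D[OF that] .
    show "((\<lambda>W. T W r) has_derivative blinfun_apply (E r W)) (at W)" if r: "r \<in> {0..\<tau>}" for r W
    proof -
      have "((\<lambda>W. integral (cbox 0 r) (\<lambda>q. F q W)) has_derivative
          blinfun_apply (integral (cbox 0 r) (\<lambda>q. D (W, q)))) (at W within UNIV)"
        using r TF[OF r] cD'[OF r]
        by (intro leibniz_rule[where fx = "\<lambda>W q. D (W, q)"]) (auto intro: D simp: integrable_on_def)
      then have "((\<lambda>W. W + integral {0..r} (\<lambda>q. F q W)) has_derivative blinfun_apply (E r W)) (at W)"
        unfolding E_def by (auto intro!: derivative_eq_intros simp: blinfun.add_left)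
      moreover have "W + integral {0..r} (\<lambda>q. F q W) = T W r" for W
        using integral_unique[OF TF[OF r]] by simp
      ultimately show ?thesis by simp
    qed
    show "continuous_on UNIV (E r)" if "r \<in> {0..\<tau>}" for r
      using integral_continuous_on_param[of UNIV 0 r "\<lambda>W q. D (W, q)"] cD'[OF that]
      unfolding E_def by (auto intro!: continuous_intros)
    show "((\<lambda>r. E r W) has_vector_derivative D (W, r)) (at r within {0..\<tau>})" if "r \<in> {0..\<tau>}" for r W
    proof -
      have "continuous_on {0..\<tau>} (\<lambda>q. D (W, q))"
        by (rule continuous_on_compose2[OF cD]) (auto intro!: continuous_intros)
      from integral_has_vector_derivative[OF this that] show ?thesis
        unfolding E_def by (auto intro!: derivative_eq_intros)
    qed
  qed
qed

section \<open>Local inversion of the flow map\<close>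

text \<open>The left inverse demanded by the inverse function theorem is the inverse of the Jacobian
  matrix.\<close>

lemma C1_local_inverse:
  fixes f :: "real ^ 'n \<Rightarrow> real ^ 'n" and f' :: "real ^ 'n \<Rightarrow> (real ^ 'n) \<Rightarrow>\<^sub>L (real ^ 'n)"
  assumes f: "\<And>x. (f has_derivative blinfun_apply (f' x)) (at x)"
    and cf: "continuous_on UNIV f'"
    and nz: "det (jacobian f (at x)) \<noteq> 0"
  obtains U V g where "open V" "f x \<in> V" "homeomorphism U V f g" "g (f x) = x"
    "(g has_derivative inv (blinfun_apply (f' x))) (at (f x))" "bij (blinfun_apply (f' x))"
proof -
  obtain K where K: "K ** jacobian f (at x) = mat 1"
    using nz by (auto simp flip: invertible_det_nz simp: invertible_def)
  have fx: "blinfun_apply (f' x) = (\<lambda>h. jacobian f (at x) *v h)"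
    using f[of x] jacobian_works[of f "at x"] has_derivative_unique differentiableI by blast
  have inv: "Blinfun ((*v) K) o\<^sub>L f' x = id_blinfun"
    by (rule blinfun_eqI)
       (simp add: bounded_linear_Blinfun_apply matrix_vector_mul_bounded_linear fx
          matrix_vector_mul_assoc K)
  obtain U V g g' where *: "x \<in> U" "open V" "f x \<in> V" "homeomorphism U V f g"
    "\<And>y. y \<in> V \<Longrightarrow> (g has_derivative (g' y)) (at y)"
    "\<And>y. y \<in> V \<Longrightarrow> g' y = inv (blinfun_apply (f' (g y)))"
    "\<And>y. y \<in> V \<Longrightarrow> bij (blinfun_apply (f' (g y)))"
    using inverse_function_theorem[OF open_UNIV f cf UNIV_I inv] by metis
  have "g (f x) = x" using * by (simp add: homeomorphism_def)
  with * show thesis by (intro that[of V U g]) (metis *)+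
qed

text \<open>Local homeomorphisms put a neighbourhood of each image point inside the range. Openness
  makes two-sided derivatives of the score meaningful on the range of the flow map.\<close>

lemma open_range_C1_nonsingular:
  fixes f :: "real ^ 'n \<Rightarrow> real ^ 'n" and f' :: "real ^ 'n \<Rightarrow> (real ^ 'n) \<Rightarrow>\<^sub>L (real ^ 'n)"
  assumes f: "\<And>x. (f has_derivative blinfun_apply (f' x)) (at x)"
    and cf: "continuous_on UNIV f'"
    and nz: "\<And>x. det (jacobian f (at x)) \<noteq> 0"
  shows "open (range f)"
proof (subst open_subopen, safe)
  fix x
  obtain U V g where "open V" "f x \<in> V" "homeomorphism U V f g"
    using C1_local_inverse[OF f cf nz, of x] by metis
  then show "\<exists>V. open V \<and> f x \<in> V \<and> V \<subseteq> range f"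
    by (auto simp: homeomorphism_def)
qed

text \<open>Near \<open>f x\<close> the map \<open>u\<close> equals \<open>F \<circ> g\<close> for a
  local inverse \<open>g\<close>, so it inherits differentiability from \<open>F\<close>. With
  \<open>f\<close> the flow map and \<open>F\<close> the velocity of labelled particles,
  \<open>u\<close> is the Eulerian velocity field.\<close>

lemma has_derivative_factor:
  fixes f :: "real ^ 'n \<Rightarrow> real ^ 'n" and f' :: "real ^ 'n \<Rightarrow> (real ^ 'n) \<Rightarrow>\<^sub>L (real ^ 'n)"
    and u F :: "real ^ 'n \<Rightarrow> 'b::real_normed_vector"
  assumes f: "\<And>x. (f has_derivative blinfun_apply (f' x)) (at x)"
    and cf: "continuous_on UNIV f'"
    and nz: "det (jacobian f (at x)) \<noteq> 0"
    and u: "\<And>x. u (f x) = F x"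
    and F: "(F has_derivative F') (at x)"
  obtains L where "(u has_derivative L) (at (f x))" "F' = L \<circ> blinfun_apply (f' x)"
proof -
  obtain U V g where g: "open V" "f x \<in> V" "homeomorphism U V f g" "g (f x) = x"
      "(g has_derivative inv (blinfun_apply (f' x))) (at (f x))" "bij (blinfun_apply (f' x))"
    using C1_local_inverse[OF f cf nz] by metis
  have "(F \<circ> g has_derivative F' \<circ> inv (blinfun_apply (f' x))) (at (f x))"
    by (rule diff_chain_at[OF g(5)]) (simp add: g F)
  then have "(u has_derivative F' \<circ> inv (blinfun_apply (f' x))) (at (f x))"
  proof (rule has_derivative_transform_within_open[OF _ g(1,2)])
    show "(F \<circ> g) y = u y" if "y \<in> V" for y
      using g(3) that u[of "g y"] by (simp add: homeomorphism_def)
  qed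
  moreover have "F' = (F' \<circ> inv (blinfun_apply (f' x))) \<circ> blinfun_apply (f' x)"
    using g(6) by (simp add: o_assoc[symmetric] bij_is_inj)
  ultimately show thesis by (rule that)
qed

section \<open>Uniform integrability and differentiation under the integral sign\<close>

text \<open>Tails of \<open>Y j\<close> are dominated by tails of \<open>X (h j)\<close>. The
  reindexing \<open>h\<close> will send an offset along a line to a point of the ball where uniform
  integrability is assumed.\<close>

lemma uniformly_integrable_dominated:
  assumes X: "uniformly_integrable M I X"
    and h: "\<And>j. j \<in> J \<Longrightarrow> h j \<in> I"
    and meas: "\<And>j. j \<in> J \<Longrightarrow> Y j \<in> borel_measurable M"
    and le: "\<And>j x. j \<in> J \<Longrightarrow> \<bar>Y j x\<bar> \<le> \<bar>X (h j) x\<bar>"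
  shows "uniformly_integrable M J Y"
  unfolding uniformly_integrable_def
proof (intro conjI ballI allI impI)
  fix \<epsilon> :: real assume "0 < \<epsilon>"
  then obtain K where K: "\<And>i. i \<in> I \<Longrightarrow>
      (\<integral>\<^sup>+ x \<in> {x. K < \<bar>X i x\<bar>}. ennreal \<bar>X i x\<bar> \<partial>M) \<le> ennreal \<epsilon>"
    using X unfolding uniformly_integrable_def by blast
  have "(\<integral>\<^sup>+ x \<in> {x. K < \<bar>Y j x\<bar>}. ennreal \<bar>Y j x\<bar> \<partial>M) \<le> ennreal \<epsilon>" if "j \<in> J" for j
  proof -
    have "(\<integral>\<^sup>+ x \<in> {x. K < \<bar>Y j x\<bar>}. ennreal \<bar>Y j x\<bar> \<partial>M)
        \<le> (\<integral>\<^sup>+ x \<in> {x. K < \<bar>X (h j) x\<bar>}. ennreal \<bar>X (h j) x\<bar> \<partial>M)"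
      using le[OF that]
      by (intro nn_integral_mono) (auto simp: indicator_def ennreal_leI intro: less_le_trans)
    also have "\<dots> \<le> ennreal \<epsilon>" using K h that by blast
    finally show ?thesis .
  qed
  then show "\<exists>K. \<forall>j\<in>J. (\<integral>\<^sup>+ x \<in> {x. K < \<bar>Y j x\<bar>}. ennreal \<bar>Y j x\<bar> \<partial>M) \<le> ennreal \<epsilon>"
    by blast
qed (fact meas)

text \<open>Choose the threshold \<open>K\<close> for a tail integral of at most 1; below it the
  integrand is at most \<open>K\<close>, and the measure is finite.\<close>

lemma (in finite_measure) uniformly_integrable_bounded:
  assumes "uniformly_integrable M I X"
  obtains C :: real where "0 \<le> C" "\<And>i. i \<in> I \<Longrightarrow> (\<integral>\<^sup>+ x. ennreal \<bar>X i x\<bar> \<partial>M) \<le> ennreal C"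
proof -
  obtain K where K: "\<And>i. i \<in> I \<Longrightarrow>
      (\<integral>\<^sup>+ x \<in> {x. K < \<bar>X i x\<bar>}. ennreal \<bar>X i x\<bar> \<partial>M) \<le> ennreal 1"
    and X[measurable]: "\<And>i. i \<in> I \<Longrightarrow> X i \<in> borel_measurable M"
    using assms zero_less_one unfolding uniformly_integrable_def by metis
  \<comment> \<open>\<open>K\<close> may be negative, whence \<open>max K 0\<close>.\<close>
  define C where "C = 1 + max K 0 * measure M (space M)"
  have "(\<integral>\<^sup>+ x. ennreal \<bar>X i x\<bar> \<partial>M) \<le> ennreal C" if [measurable]: "i \<in> I" for i
  proof -
    have "(\<integral>\<^sup>+ x. ennreal \<bar>X i x\<bar> \<partial>M)
        \<le> (\<integral>\<^sup>+ x. ennreal \<bar>X i x\<bar> * indicator {x. K < \<bar>X i x\<bar>} x + ennreal (max K 0) \<partial>M)"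
      by (intro nn_integral_mono) (auto simp: indicator_def intro!: ennreal_leI)
    also have "\<dots> = (\<integral>\<^sup>+ x. ennreal \<bar>X i x\<bar> * indicator {x. K < \<bar>X i x\<bar>} x \<partial>M)
        + ennreal (max K 0) * emeasure M (space M)"
      using X[OF that] by (subst nn_integral_add) auto
    also have "\<dots> \<le> ennreal 1 + ennreal (max K 0) * emeasure M (space M)"
      by (intro add_right_mono K that)
    also have "\<dots> = ennreal C"
      by (simp add: C_def emeasure_eq_measure ennreal_mult')
    finally show ?thesis .
  qed
  moreover have "0 \<le> C" by (simp add: C_def)
  ultimately show thesis using that by blast
qed

lemma (in finite_measure) uniformly_integrable_integrable:
  assumes "uniformly_integrable M I X" "i \<in> I"
  shows "integrable M (X i)"
proof -
  obtain C where "(\<integral>\<^sup>+ x. ennreal \<bar>X i x\<bar> \<partial>M) \<le> ennreal C"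
    using uniformly_integrable_bounded[OF assms(1)] assms(2) by metis
  also have "\<dots> < \<infinity>" by simp
  finally have "(\<integral>\<^sup>+ x. ennreal (norm (X i x)) \<partial>M) < \<infinity>" by simp
  moreover have "X i \<in> borel_measurable M"
    using assms by (simp add: uniformly_integrable_def)
  ultimately show ?thesis by (rule integrableI_bounded[rotated])
qed

text \<open>Vitali's convergence theorem, by truncation.\<close>

lemma (in finite_measure) uniformly_integrable_LIMSEQ_integral:
  fixes X :: "'i \<Rightarrow> 'a \<Rightarrow> real"
  assumes ui: "uniformly_integrable M I X"
    and a: "\<And>n. a n \<in> I" and i: "i \<in> I"
    and lim: "AE x in M. (\<lambda>n. X (a n) x) \<longlonglongrightarrow> X i x"
  shows "(\<lambda>n. \<integral>x. X (a n) x \<partial>M) \<longlonglongrightarrow> (\<integral>x. X i x \<partial>M)"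
proof (rule LIMSEQ_I)
  fix \<epsilon> :: real assume "0 < \<epsilon>"
  then have "0 < \<epsilon> / 3" by simp
  then obtain K where K: "\<And>j. j \<in> I \<Longrightarrow>
      (\<integral>\<^sup>+ x \<in> {x. K < \<bar>X j x\<bar>}. ennreal \<bar>X j x\<bar> \<partial>M) \<le> ennreal (\<epsilon> / 3)"
    using ui unfolding uniformly_integrable_def by blast
  have X[measurable]: "\<And>j. j \<in> I \<Longrightarrow> X j \<in> borel_measurable M"
    using ui unfolding uniformly_integrable_def by blast
  define L where "L = max K 0"
  \<comment> \<open>Clamping to \<open>[-L, L]\<close> changes \<open>X j x\<close> only where
    \<open>K < \<bar>X j x\<bar>\<close>, and there by at most
    \<open>\<bar>X j x\<bar>\<close>.\<close>
  define c where "c y = max (- L) (min L y)" for y :: real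
  have c_bound: "\<bar>c y\<bar> \<le> L" for y by (auto simp: c_def L_def)
  have [measurable]: "c \<in> borel_measurable borel" unfolding c_def by measurable
  have c_int: "integrable M (\<lambda>x. c (X j x))" if "j \<in> I" for j
    using X[OF that] c_bound by (intro integrable_const_bound[of _ L]) auto
  have near: "\<bar>(\<integral>x. X j x \<partial>M) - (\<integral>x. c (X j x) \<partial>M)\<bar> \<le> \<epsilon> / 3" if j: "j \<in> I" for j
  proof -
    note int = uniformly_integrable_integrable[OF ui j] c_int[OF j]
    have "\<bar>(\<integral>x. X j x \<partial>M) - (\<integral>x. c (X j x) \<partial>M)\<bar> = \<bar>\<integral>x. X j x - c (X j x) \<partial>M\<bar>"
      using int by simp
    also have "\<dots> \<le> (\<integral>x. \<bar>X j x - c (X j x)\<bar> \<partial>M)"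
      by (rule integral_abs_bound)
    also have "\<dots> \<le> \<epsilon> / 3"
    proof (rule integral_real_bounded)
      have "(\<integral>\<^sup>+ x. ennreal \<bar>X j x - c (X j x)\<bar> \<partial>M)
          \<le> (\<integral>\<^sup>+ x \<in> {x. K < \<bar>X j x\<bar>}. ennreal \<bar>X j x\<bar> \<partial>M)"
        by (intro nn_integral_mono) (auto simp: indicator_def c_def L_def intro!: ennreal_leI)
      with K[OF j] show "(\<integral>\<^sup>+ x. ennreal \<bar>X j x - c (X j x)\<bar> \<partial>M) \<le> ennreal (\<epsilon> / 3)"
        by (rule order_trans[rotated])
    qed (use \<open>0 < \<epsilon>\<close> in simp)
    finally show ?thesis .
  qed
  \<comment> \<open>The clamped functions are bounded by the constant \<open>L\<close>, which is
    integrable for a finite measure.\<close>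
  have "(\<lambda>n. \<integral>x. c (X (a n) x) \<partial>M) \<longlonglongrightarrow> (\<integral>x. c (X i x) \<partial>M)"
  proof (rule integral_dominated_convergence[where w = "\<lambda>_. L"])
    have "isCont c y" for y unfolding c_def by (intro continuous_intros)
    from isCont_tendsto_compose[OF this]
    show "AE x in M. (\<lambda>n. c (X (a n) x)) \<longlonglongrightarrow> c (X i x)"
      by (rule eventually_mono[OF lim])
  qed (use a i X c_bound in auto)
  then obtain N where N: "\<And>n. n \<ge> N \<Longrightarrow> \<bar>(\<integral>x. c (X (a n) x) \<partial>M) - (\<integral>x. c (X i x) \<partial>M)\<bar> < \<epsilon> / 3"
    using \<open>0 < \<epsilon> / 3\<close> unfolding LIMSEQ_iff real_norm_def by blast
  have "\<bar>(\<integral>x. X (a n) x \<partial>M) - (\<integral>x. X i x \<partial>M)\<bar> < \<epsilon>" if "n \<ge> N" for n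
    using N[OF that] near[OF i] near[OF a[of n]] by (simp add: abs_if split: if_splits)
  then show "\<exists>N. \<forall>n\<ge>N. norm ((\<integral>x. X (a n) x \<partial>M) - (\<integral>x. X i x \<partial>M)) < \<epsilon>"
    by auto
qed

text \<open>By the fundamental theorem of calculus and Fubini, the increment of the integral between
  0 and \<open>h\<close> is \<open>h\<close> times the mean of \<open>G (h * q)\<close> over
  \<open>q\<close> in \<open>[0, 1]\<close>; Vitali's theorem makes \<open>G\<close> continuous at
  0, so these means tend to \<open>G 0\<close>. The exceptional null set in \<open>deriv\<close> is
  common to all \<open>q\<close>, as the fundamental theorem requires along a whole segment.\<close>

lemma (in finite_measure) has_real_derivative_integral_uniformly_integrable:
  fixes \<phi> g :: "real \<Rightarrow> 'a \<Rightarrow> real"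
  assumes \<delta>: "0 < \<delta>"
    and g_meas: "(\<lambda>(q, x). g q x) \<in> borel_measurable (borel \<Otimes>\<^sub>M M)"
    and ui: "uniformly_integrable M {-\<delta><..<\<delta>} g"
    and \<phi>: "\<And>q. q \<in> {-\<delta><..<\<delta>} \<Longrightarrow> integrable M (\<phi> q)"
    and deriv: "AE x in M. \<forall>q\<in>{-\<delta><..<\<delta>}.
      ((\<lambda>q. \<phi> q x) has_real_derivative g q x) (at q) \<and> isCont (\<lambda>q. g q x) q"
  shows "((\<lambda>q. \<integral>x. \<phi> q x \<partial>M) has_real_derivative (\<integral>x. g 0 x \<partial>M)) (at 0)"
proof -
  define G where "G q = (\<integral>x. g q x \<partial>M)" for q
  have 0: "0 \<in> {-\<delta><..<\<delta>}" using \<delta> by simp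
  have G_lim: "(G \<longlongrightarrow> G 0) (at 0 within {-\<delta><..<\<delta>})"
    unfolding tendsto_at_iff_sequentially
  proof (intro allI impI)
    fix a :: "nat \<Rightarrow> real" assume a: "\<forall>n. a n \<in> {-\<delta><..<\<delta>} - {0}" "a \<longlonglongrightarrow> 0"
    have "AE x in M. (\<lambda>n. g (a n) x) \<longlonglongrightarrow> g 0 x"
      using deriv
    proof eventually_elim
      case (elim x)
      then have "isCont (\<lambda>q. g q x) 0" using 0 by blast
      then show ?case using a(2) by (rule isCont_tendsto_compose)
    qed
    from uniformly_integrable_LIMSEQ_integral[OF ui _ 0 this] a(1)
    show "(G \<circ> a) \<longlonglongrightarrow> G 0" by (simp add: G_def comp_def)
  qed
  obtain C where C: "0 \<le> C" "\<And>q. q \<in> {-\<delta><..<\<delta>} \<Longrightarrow> (\<integral>\<^sup>+ x. ennreal \<bar>g q x\<bar> \<partial>M) \<le> ennreal C"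
    using uniformly_integrable_bounded[OF ui] by metis
  \<comment> \<open>Scaling to the unit interval treats both signs of \<open>h\<close> at
    once.\<close>
  have scaled: "integrable lborel (\<lambda>q. indicator {0..1} q * G (h * q))"
      "(\<integral>x. \<phi> h x \<partial>M) - (\<integral>x. \<phi> 0 x \<partial>M) = h * (\<integral>q. indicator {0..1} q * G (h * q) \<partial>lborel)"
    if h: "h \<in> {-\<delta><..<\<delta>}" for h
  proof -
    have hq: "h * q \<in> {-\<delta><..<\<delta>}" if "0 \<le> q" "q \<le> 1" for q
    proof -
      have "\<bar>h * q\<bar> \<le> \<bar>h\<bar> * 1" unfolding abs_mult using that by (intro mult_left_mono) auto
      with h show ?thesis by auto
    qed
    define k where "k q x = indicator {0..1} q * g (h * q) x" for q x
    interpret P: pair_sigma_finite lborel M ..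
    have k_meas: "case_prod k \<in> borel_measurable (lborel \<Otimes>\<^sub>M M)"
    proof -
      have "(\<lambda>p. (h * fst p, snd p)) \<in> (lborel \<Otimes>\<^sub>M M) \<rightarrow>\<^sub>M (borel \<Otimes>\<^sub>M M)"
        by measurable
      from measurable_compose[OF this g_meas]
      have "(\<lambda>p. g (h * fst p) (snd p)) \<in> borel_measurable (lborel \<Otimes>\<^sub>M M)"
        by simp
      then have "(\<lambda>p. indicator {0..1} (fst p) * g (h * fst p) (snd p))
          \<in> borel_measurable (lborel \<Otimes>\<^sub>M M)"
        by measurable
      then show ?thesis by (simp add: k_def case_prod_beta')
    qed
    \<comment> \<open>Fubini's hypothesis holds because the \<open>L^1\<close> norms of the sections
      in \<open>x\<close> are bounded by \<open>C\<close> and \<open>q\<close> ranges over a set of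
      measure 1.\<close>
    have k_int: "integrable (lborel \<Otimes>\<^sub>M M) (case_prod k)"
    proof (rule integrableI_bounded[OF k_meas])
      have "(\<integral>\<^sup>+ p. ennreal (norm (case_prod k p)) \<partial>(lborel \<Otimes>\<^sub>M M))
          = (\<integral>\<^sup>+ q. \<integral>\<^sup>+ x. ennreal \<bar>k q x\<bar> \<partial>M \<partial>lborel)"
        using k_meas by (subst nn_integral_fst[symmetric]) (auto simp: case_prod_beta)
      also have "\<dots> \<le> (\<integral>\<^sup>+ q. ennreal C * indicator {0..1} q \<partial>(lborel :: real measure))"
      proof (intro nn_integral_mono)
        fix q :: real
        show "(\<integral>\<^sup>+ x. ennreal \<bar>k q x\<bar> \<partial>M) \<le> ennreal C * indicator {0..1} q"
          using C(2)[OF hq[of q]] by (auto simp: k_def indicator_def)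
      qed
      also have "\<dots> = ennreal C" by (simp add: nn_integral_cmult)
      also have "\<dots> < \<infinity>" by simp
      finally show "(\<integral>\<^sup>+ p. ennreal (norm (case_prod k p)) \<partial>(lborel \<Otimes>\<^sub>M M)) < \<infinity>" .
    qed
    have inner: "(\<integral>x. k q x \<partial>M) = indicator {0..1} q * G (h * q)" for q
      by (simp add: k_def G_def)
    show "integrable lborel (\<lambda>q. indicator {0..1} q * G (h * q))"
      using P.integrable_fst[OF k_int] by (simp add: inner)
    have "(\<integral>x. \<phi> h x \<partial>M) - (\<integral>x. \<phi> 0 x \<partial>M) = (\<integral>x. \<phi> h x - \<phi> 0 x \<partial>M)"
      using \<phi> h 0 by simp
    also have "\<dots> = (\<integral>x. h * (\<integral>q. k q x \<partial>lborel) \<partial>M)"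
    proof (rule integral_cong_AE)
      show "AE x in M. \<phi> h x - \<phi> 0 x = h * (\<integral>q. k q x \<partial>lborel)"
        using deriv
      proof eventually_elim
        case (elim x)
        have "(\<integral>q. (h * g (h * q) x) * indicator {0..1} q \<partial>lborel) = \<phi> (h * 1) x - \<phi> (h * 0) x"
        proof (rule integral_FTC_Icc_real)
          fix q :: real assume q: "0 \<le> q" "q \<le> 1"
          note e = elim[rule_format, OF hq[OF q]]
          have "((\<lambda>q. h * q) has_real_derivative h) (at q)"
            by (auto intro!: derivative_eq_intros)
          from DERIV_chain'[OF this conjunct1[OF e]]
          show "((\<lambda>q. \<phi> (h * q) x) has_real_derivative h * g (h * q) x) (at q)"
            by (simp add: mult.commute)
          have "isCont (\<lambda>q. g (h * q) x) q"
            using conjunct2[OF e] by (intro isCont_o2[where f = "\<lambda>q. h * q" and g = "\<lambda>q. g q x"]) simp_all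
          then show "isCont (\<lambda>q. h * g (h * q) x) q" by simp
        qed simp
        moreover have "(\<integral>q. (h * g (h * q) x) * indicator {0..1} q \<partial>lborel)
            = h * (\<integral>q. k q x \<partial>lborel)"
          by (subst integral_mult_right_zero[symmetric])
             (simp add: k_def mult_ac)
        ultimately show ?case by simp
      qed
      show "(\<lambda>x. h * (\<integral>q. k q x \<partial>lborel)) \<in> borel_measurable M"
        using P.integrable_snd[OF k_int] by (intro borel_measurable_times) auto
    qed (use \<phi> h 0 in auto)
    also have "\<dots> = h * (\<integral>q. indicator {0..1} q * G (h * q) \<partial>lborel)"
      using P.Fubini_integral[OF k_int] by (simp add: inner)
    finally show "(\<integral>x. \<phi> h x \<partial>M) - (\<integral>x. \<phi> 0 x \<partial>M)
        = h * (\<integral>q. indicator {0..1} q * G (h * q) \<partial>lborel)" .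
  qed
  have "((\<lambda>h. ((\<integral>x. \<phi> (0 + h) x \<partial>M) - (\<integral>x. \<phi> 0 x \<partial>M)) / h) \<longlongrightarrow> G 0) (at 0)"
  proof (rule LIM_I)
    fix \<epsilon> :: real assume \<epsilon>: "0 < \<epsilon>"
    then have "eventually (\<lambda>q. dist (G q) (G 0) < \<epsilon> / 2) (at 0 within {-\<delta><..<\<delta>})"
      using G_lim by (intro tendstoD) auto
    \<comment> \<open>The punctured filter leaves out \<open>q = 0\<close>, where the difference is
      0, so the estimate holds there as well.\<close>
    then obtain d where d: "0 < d" "\<And>q. q \<in> {-\<delta><..<\<delta>} \<Longrightarrow> \<bar>q\<bar> < d \<Longrightarrow> \<bar>G q - G 0\<bar> \<le> \<epsilon> / 2"
      using \<epsilon> unfolding eventually_at dist_real_def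
      by (metis abs_zero diff_0_right diff_self divide_nonneg_nonneg less_eq_real_def zero_le_numeral)
    show "\<exists>s>0. \<forall>h. h \<noteq> 0 \<and> norm (h - 0) < s \<longrightarrow>
        norm (((\<integral>x. \<phi> (0 + h) x \<partial>M) - (\<integral>x. \<phi> 0 x \<partial>M)) / h - G 0) < \<epsilon>"
    proof (intro exI[of _ "min d \<delta>"] conjI allI impI)
      fix h :: real assume "h \<noteq> 0 \<and> norm (h - 0) < min d \<delta>"
      then have h: "h \<noteq> 0" "h \<in> {-\<delta><..<\<delta>}" "\<bar>h\<bar> < d" by auto
      let ?i = "indicator {0..1} :: real \<Rightarrow> real"
      have "((\<integral>x. \<phi> (0 + h) x \<partial>M) - (\<integral>x. \<phi> 0 x \<partial>M)) / h - G 0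
          = (\<integral>q. ?i q * G (h * q) \<partial>lborel) - (\<integral>q. ?i q * G 0 \<partial>lborel)"
        using scaled(2)[OF h(2)] h(1) by simp
      also have "\<dots> = (\<integral>q. ?i q * G (h * q) - ?i q * G 0 \<partial>lborel)"
        using scaled(1)[OF h(2)] by simp
      also have "\<bar>\<dots>\<bar> \<le> (\<integral>q. ?i q * (\<epsilon> / 2) \<partial>lborel)"
      proof (rule integral_abs_bound_integral)
        fix q :: real
        have "\<bar>G (h * q) - G 0\<bar> \<le> \<epsilon> / 2" if "0 \<le> q" "q \<le> 1"
        proof -
          have "\<bar>h * q\<bar> \<le> \<bar>h\<bar> * 1" unfolding abs_mult using that by (intro mult_left_mono) auto
          with h show ?thesis by (intro d) auto
        qed
        then show "\<bar>?i q * G (h * q) - ?i q * G 0\<bar> \<le> ?i q * (\<epsilon> / 2)"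
          by (auto simp: indicator_def)
      qed (use scaled(1)[OF h(2)] in simp_all)
      also have "\<dots> < \<epsilon>" using \<epsilon> by simp
      finally show "norm (((\<integral>x. \<phi> (0 + h) x \<partial>M) - (\<integral>x. \<phi> 0 x \<partial>M)) / h - G 0) < \<epsilon>"
        by simp
    qed (use d \<delta> in auto)
  qed
  then show ?thesis by (simp add: DERIV_def G_def)
qed

section \<open>Divergence of the collision flux and the radial kernel\<close>

lemma bounded_bilinear_matrix_vector_mult:
  "bounded_bilinear ((*v) :: real ^ 'n ^ 'm \<Rightarrow> real ^ 'n \<Rightarrow> real ^ 'm)"
  unfolding bilinear_conv_bounded_bilinear[symmetric] bilinear_def
  by (auto intro!: linearI simp: matrix_vector_mult_add_rdistrib matrix_vector_right_distrib
      scaleR_matrix_vector_assoc matrix_vector_mult_scaleR)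

lemma divergence_eq_sum:
  assumes "(F has_derivative F') (at v)"
  shows "divergence F v = (\<Sum>i\<in>UNIV. F' (axis i 1) $ i)"
  using frechet_derivative_at[OF assms]
  by (simp add: divergence_def trace_def jacobian_def matrix_def)

lemma perp_proj_mult:
  "perp_proj z *v y = y - ((z \<bullet> y) / (z \<bullet> z)) *\<^sub>R z"
proof -
  have "(\<Sum>j\<in>UNIV. (if i = j then 1 else 0) * y $ j - z $ i * z $ j / (z \<bullet> z) * y $ j)
      = y $ i - (z \<bullet> y) / (z \<bullet> z) * z $ i" for i
  proof -
    have "(\<Sum>j\<in>UNIV. z $ i * z $ j / (z \<bullet> z) * y $ j) = (\<Sum>j\<in>UNIV. (z $ i / (z \<bullet> z)) * (z $ j * y $ j))"
      by (intro sum.cong) auto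
    also have "\<dots> = (z $ i / (z \<bullet> z)) * (z \<bullet> y)"
      by (simp add: inner_vec_def sum_distrib_left)
    finally show ?thesis
      by (simp add: sum_subtractf if_distrib[of "\<lambda>a. a * _"] cong: if_cong)
  qed
  then show ?thesis
    by (simp add: vec_eq_iff perp_proj_def matrix_vector_mult_def mat_def left_diff_distrib
        power2_norm_eq_inner)
qed

text \<open>For \<open>z = 0\<close> division by zero makes \<open>perp_proj 0\<close> the identity,
  and the inner product vanishes because of \<open>z\<close> itself.\<close>

lemma inner_perp_proj: "z \<bullet> (perp_proj z *v y) = 0"
  by (cases "z = 0") (simp_all add: perp_proj_mult inner_diff_right)

text \<open>The gradient of the radial factor is parallel to \<open>v - w\<close>, hence orthogonal to the flux.\<close>

lemma divergence_collision_flux_radial: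
  fixes A :: "real ^ 'n \<Rightarrow> real ^ 'n ^ 'n"
  assumes A: "\<And>z. z \<noteq> 0 \<Longrightarrow> A z = (C * norm z powr p) *\<^sub>R perp_proj z"
    and vw: "v \<noteq> w" and s: "s differentiable (at v)"
  shows "divergence (collision_flux A s w) v
    = C * norm (v - w) powr p * divergence (collision_flux perp_proj s w) v"
proof -
  let ?F = "collision_flux perp_proj s w"
  have F: "?F = (\<lambda>x. (s x - s w) - (((x - w) \<bullet> (s x - s w)) / ((x - w) \<bullet> (x - w))) *\<^sub>R (x - w))"
    by (simp add: collision_flux_def perp_proj_mult fun_eq_iff)
  have "?F differentiable (at v)"
    unfolding F using s vw
    by (intro differentiable_diff differentiable_scaleR differentiable_divide differentiable_inner
        differentiable_ident differentiable_const) auto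
  then obtain F' where F': "(?F has_derivative F') (at v)"
    by (auto simp: differentiable_def)
  \<comment> \<open>\<open>\<kappa> *\<^sub>R (v - w)\<close> is the gradient of
    \<open>C * norm (x - w) powr p\<close> at \<open>v\<close>; in other words
    \<open>\<kappa>\<close> is \<open>C * p * norm (v - w) powr (p - 2)\<close>.\<close>
  define \<kappa> where "\<kappa> = C * (norm (v - w) powr p * (p / (norm (v - w))\<^sup>2))"
  have "((\<lambda>x. norm (x - w)) has_derivative (\<lambda>h. ((v - w) \<bullet> h) / norm (v - w))) (at v)"
    using vw
    by (intro has_derivative_compose[where g = norm, OF _ has_derivative_norm, THEN has_derivative_eq_rhs])
       (auto intro!: derivative_eq_intros simp: sgn_div_norm inner_commute divide_inverse)
  then have \<psi>: "((\<lambda>x. C * norm (x - w) powr p) has_derivative (\<lambda>h. \<kappa> * ((v - w) \<bullet> h))) (at v)"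
    using vw
    by (auto intro!: derivative_eq_intros
        simp: fun_eq_iff \<kappa>_def power2_eq_square field_simps)
  have "((\<lambda>x. (C * norm (x - w) powr p) *\<^sub>R ?F x) has_derivative
      (\<lambda>h. (C * norm (v - w) powr p) *\<^sub>R F' h + (\<kappa> * ((v - w) \<bullet> h)) *\<^sub>R ?F v)) (at v)"
    by (rule has_derivative_scaleR[OF \<psi> F'])
  \<comment> \<open>The formula for \<open>A\<close> is available only off the origin; the
    complement of \<open>{w}\<close> is an open neighbourhood of \<open>v\<close> on which it
    applies.\<close>
  then have "(collision_flux A s w has_derivative
      (\<lambda>h. (C * norm (v - w) powr p) *\<^sub>R F' h + (\<kappa> * ((v - w) \<bullet> h)) *\<^sub>R ?F v)) (at v)"
    by (rule has_derivative_transform_within_open[of _ _ _ _ "- {w}"])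
       (use vw in \<open>auto simp: A collision_flux_def scaleR_matrix_vector_assoc\<close>)
  from divergence_eq_sum[OF this] have "divergence (collision_flux A s w) v
      = C * norm (v - w) powr p * (\<Sum>i\<in>UNIV. F' (axis i 1) $ i)
        + \<kappa> * (\<Sum>i\<in>UNIV. (v - w) $ i * ?F v $ i)"
    by (simp add: sum.distrib sum_distrib_left inner_axis mult_ac)
  also have "(\<Sum>i\<in>UNIV. (v - w) $ i * ?F v $ i) = (v - w) \<bullet> ?F v"
    by (simp add: inner_vec_def)
  also have "\<dots> = 0" by (simp add: collision_flux_def inner_perp_proj)
  finally show ?thesis by (simp add: divergence_eq_sum[OF F'])
qed

section \<open>The flux off the diagonal: derivative and continuity\<close>

text \<open>\<open>R\<close> will be the range of the flow map at a fixed time.\<close>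

locale C1_collision =
  fixes A :: "real ^ 'n \<Rightarrow> real ^ 'n ^ 'n" and A' :: "real ^ 'n \<Rightarrow> (real ^ 'n) \<Rightarrow>\<^sub>L (real ^ 'n ^ 'n)"
    and s :: "real ^ 'n \<Rightarrow> real ^ 'n" and s' :: "real ^ 'n \<Rightarrow> (real ^ 'n) \<Rightarrow>\<^sub>L (real ^ 'n)"
    and R :: "(real ^ 'n) set"
  assumes A_deriv: "z \<noteq> 0 \<Longrightarrow> (A has_derivative blinfun_apply (A' z)) (at z)"
    and A'_cont: "continuous_on (- {0}) A'"
    and s_deriv: "x \<in> R \<Longrightarrow> (s has_derivative blinfun_apply (s' x)) (at x)"
    and s'_cont: "continuous_on R s'"
    and R_open: "open R"
begin

text \<open>The product-rule formula is named because, unlike \<open>frechet_derivative\<close>, it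
  displays its joint continuity in both velocities, from which measurability is derived.\<close>

definition dflux :: "real ^ 'n \<Rightarrow> real ^ 'n \<Rightarrow> real ^ 'n \<Rightarrow> real ^ 'n" where
  "dflux w x h = A' (x - w) h *v (s x - s w) + A (x - w) *v s' x h"

lemma flux_has_derivative:
  assumes "x \<in> R" "x \<noteq> w"
  shows "(collision_flux A s w has_derivative dflux w x) (at x)"
proof -
  interpret bounded_bilinear "(*v) :: real ^ 'n ^ 'n \<Rightarrow> real ^ 'n \<Rightarrow> real ^ 'n"
    by (rule bounded_bilinear_matrix_vector_mult)
  have "((\<lambda>x. A (x - w)) has_derivative (\<lambda>h. A' (x - w) h)) (at x)"
    using assms by (intro has_derivative_compose[where g = A, OF _ A_deriv, THEN has_derivative_eq_rhs])
      (auto intro!: derivative_eq_intros)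
  from FDERIV[OF this has_derivative_diff[OF s_deriv[OF assms(1)] has_derivative_const]]
  show ?thesis
    by (rule has_derivative_eq_rhs[THEN has_derivative_transform_within_open[OF _ open_UNIV]])
       (auto simp: dflux_def collision_flux_def fun_eq_iff)
qed

lemma continuous_on_A: "continuous_on (- {0}) A"
  by (intro continuous_at_imp_continuous_on ballI has_derivative_continuous[OF A_deriv]) simp

lemma continuous_on_s: "continuous_on R s"
  by (meson s_deriv continuous_at_imp_continuous_on has_derivative_continuous)

text \<open>The parameter \<open>p\<close> lets it serve both for a label \<open>W\<close> alone and
  for a pair of an offset \<open>q\<close> and a label.\<close>

lemma continuous_on_flux:
  assumes "continuous_on S x" "continuous_on S w" "x ` S \<subseteq> R" "w ` S \<subseteq> R" "\<And>p. p \<in> S \<Longrightarrow> x p \<noteq> w p"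
  shows "continuous_on S (\<lambda>p. collision_flux A s (w p) (x p))"
    "continuous_on S (\<lambda>p. dflux (w p) (x p) h)"
proof -
  interpret bounded_bilinear "(*v) :: real ^ 'n ^ 'n \<Rightarrow> real ^ 'n \<Rightarrow> real ^ 'n"
    by (rule bounded_bilinear_matrix_vector_mult)
  note compose = continuous_on_compose2[OF _ assms(1)] continuous_on_compose2[OF _ assms(2)]
  have c: "continuous_on S (\<lambda>p. A (x p - w p))" "continuous_on S (\<lambda>p. A' (x p - w p))"
    using assms
    by (auto intro!: continuous_on_compose2[OF continuous_on_A] continuous_on_compose2[OF A'_cont]
        continuous_intros)
  have d: "continuous_on S (\<lambda>p. s (x p))" "continuous_on S (\<lambda>p. s (w p))" "continuous_on S (\<lambda>p. s' (x p))"
    using assms by (auto intro!: compose[OF continuous_on_s] compose[OF s'_cont])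
  show "continuous_on S (\<lambda>p. collision_flux A s (w p) (x p))"
    "continuous_on S (\<lambda>p. dflux (w p) (x p) h)"
    unfolding collision_flux_def dflux_def by (intro continuous_on continuous_intros c d)+
qed

end

section \<open>The trace of the derivative of the collision integral\<close>

text \<open>The axis line fixes every coordinate except \<open>i\<close>; a second coordinate
  \<open>j\<close> places it in a hyperplane, which is closed and Lebesgue-null. In dimension one
  the line would be the whole space.\<close>

lemma negligible_axis_line:
  assumes "CARD('n) \<ge> 2"
  obtains N :: "(real ^ 'n) set" where "N \<in> null_sets lborel" "\<And>q. v + q *\<^sub>R axis i 1 \<in> N"
proof -
  have "\<not> (UNIV :: 'n set) \<subseteq> {i}"
    using assms card_mono[of "{i}" UNIV] by auto
  then obtain j where j: "j \<noteq> i" by auto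
  define N where "N = {x :: real ^ 'n. x $ j = v $ j}"
  have "closed N" unfolding N_def by (intro closed_Collect_eq continuous_intros)
  moreover have "negligible N"
    unfolding N_def cart_eq_inner_axis
    by (intro negligible_standard_hyperplane) (simp add: axis_in_Basis_iff)
  ultimately have "N \<in> null_sets lborel"
    by (simp add: negligible_iff_null_sets null_sets_completion_iff borel_closed)
  then show thesis
    by (rule that) (use j in \<open>auto simp: N_def axis_def\<close>)
qed

context C1_collision
begin

text \<open>Where \<open>T W = v\<close> the flux need not be differentiable and its divergence is a junk value, but one
  that does not depend on \<open>W\<close>, so measurability holds without completing the measure.\<close>

lemma
  fixes M :: "'m::{second_countable_topology, t2_space} measure" and T :: "'m \<Rightarrow> real ^ 'n"
  assumes M: "sets M = sets borel" and cT: "continuous_on UNIV T" and TR: "\<And>W. T W \<in> R" and v: "v \<in> R"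
  shows borel_measurable_flux: "(\<lambda>W. collision_flux A s (T W) v) \<in> borel_measurable M"
    and borel_measurable_divergence_flux: "(\<lambda>W. divergence (collision_flux A s (T W)) v) \<in> borel_measurable M"
proof -
  define Q where "Q = {W. T W \<noteq> v}"
  have "open Q" unfolding Q_def
    using cT by (intro open_Collect_neq continuous_intros)
  then have Q: "Q \<in> sets borel" by simp
  have cO: "continuous_on Q (\<lambda>W. collision_flux A s (T W) v)" "continuous_on Q (\<lambda>W. dflux (T W) v h)" for h
    using v TR
    by (auto intro!: continuous_on_flux continuous_on_subset[OF cT] simp: Q_def)
  have div: "divergence (collision_flux A s (T W)) v = (\<Sum>i\<in>UNIV. dflux (T W) v (axis i 1) $ i)"
    if "W \<in> Q" for W
    using divergence_eq_sum[OF flux_has_derivative[OF v]] that by (auto simp: Q_def)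
  have "(\<lambda>W. if W \<in> Q then collision_flux A s (T W) v else collision_flux A s v v) \<in> borel_measurable borel"
    by (intro borel_measurable_continuous_on_if Q cO continuous_on_const)
  also have "(\<lambda>W. if W \<in> Q then collision_flux A s (T W) v else collision_flux A s v v)
      = (\<lambda>W. collision_flux A s (T W) v)"
    by (auto simp: Q_def)
  finally show "(\<lambda>W. collision_flux A s (T W) v) \<in> borel_measurable M"
    by (simp cong: measurable_cong_sets add: M)
  have "(\<lambda>W. if W \<in> Q then \<Sum>i\<in>UNIV. dflux (T W) v (axis i 1) $ i
      else divergence (collision_flux A s v) v) \<in> borel_measurable borel"
    by (intro borel_measurable_continuous_on_if Q cO continuous_on_const continuous_intros)
  also have "(\<lambda>W. if W \<in> Q then \<Sum>i\<in>UNIV. dflux (T W) v (axis i 1) $ i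
      else divergence (collision_flux A s v) v) = (\<lambda>W. divergence (collision_flux A s (T W)) v)"
    using div by (auto simp: Q_def)
  finally show "(\<lambda>W. divergence (collision_flux A s (T W)) v) \<in> borel_measurable M"
    by (simp cong: measurable_cong_sets add: M)
qed

text \<open>Differentiability of \<open>u\<close> is supplied by the flow, so only the diagonal
  entries of \<open>L\<close> remain to be identified. Each is an ordinary derivative along an axis
  line through \<open>v\<close>, which can be taken under the integral.\<close>

lemma trace_derivative_integral_flux:
  fixes M :: "'m::{second_countable_topology, t2_space} measure" and T :: "'m \<Rightarrow> real ^ 'n"
  assumes dim: "CARD('n) \<ge> 2" and finM: "finite_measure M" and M: "sets M = sets borel"
    and cT: "continuous_on UNIV T" and TR: "\<And>W. T W \<in> R" and v: "v \<in> R"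
    and null: "\<And>N. N \<in> null_sets lborel \<Longrightarrow> AE W in M. T W \<notin> N"
    and int: "\<And>x. x \<in> R \<Longrightarrow> integrable M (\<lambda>W. collision_flux A s (T W) x)"
    and u: "\<And>x. x \<in> R \<Longrightarrow> u x = (\<integral>W. collision_flux A s (T W) x \<partial>M)"
    and L: "(u has_derivative L) (at v)"
    and \<rho>: "0 < \<rho>" and ui: "uniformly_integrable M (ball v \<rho>)
      (\<lambda>x W. onorm (frechet_derivative (collision_flux A s (T W)) (at x)))"
  shows "trace (matrix L) = (\<integral>W. divergence (collision_flux A s (T W)) v \<partial>M)"
proof -
  interpret finite_measure M by (fact finM)
  obtain \<delta> where \<delta>: "0 < \<delta>" "ball v \<delta> \<subseteq> R \<inter> ball v \<rho>"
    using R_open v \<rho> by (meson IntI centre_in_ball open_Int open_ball open_contains_ball)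
  define e :: "'n \<Rightarrow> real ^ 'n" where "e i = axis i 1" for i
  define x where "x i q = v + q *\<^sub>R e i" for i q
  have x_ball: "x i q \<in> ball v \<delta>" if "q \<in> {-\<delta><..<\<delta>}" for i q
    using that by (auto simp: x_def e_def dist_norm)
  \<comment> \<open>\<open>Q i\<close> collects the offsets and labels without a collision; it is
    open and \<open>dflux\<close> is continuous on it, so the extension \<open>g i\<close> by 0 is
    jointly Borel measurable.\<close>
  define Q where "Q i = {(q, W). q \<in> {-\<delta><..<\<delta>} \<and> T W \<noteq> x i q}" for i
  define g where "g i q W = (if (q, W) \<in> Q i then dflux (T W) (x i q) (e i) $ i else 0)" for i q W
  have ui_g: "uniformly_integrable M {-\<delta><..<\<delta>} (g i)"
    and deriv: "((\<lambda>q. \<integral>W. collision_flux A s (T W) (x i q) $ i \<partial>M) has_real_derivative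
      (\<integral>W. g i 0 W \<partial>M)) (at 0)" for i
  proof -
    have cx: "continuous_on S (\<lambda>p. x i (q p))" if "continuous_on S q" for S q
      unfolding x_def using that by (intro continuous_intros)
    have cT2: "continuous_on S (\<lambda>p. T (snd p))" for S :: "(real \<times> 'm) set"
      by (rule continuous_on_compose2[OF cT]) (auto intro!: continuous_intros)
    have "open ({-\<delta><..<\<delta>} \<times> UNIV \<inter> {p. T (snd p) \<noteq> x i (fst p)})"
      by (intro open_Int open_Times open_Collect_neq cT2 cx continuous_intros) auto
    also have "{-\<delta><..<\<delta>} \<times> UNIV \<inter> {p. T (snd p) \<noteq> x i (fst p)} = Q i"
      by (auto simp: Q_def)
    finally have Q: "Q i \<in> sets borel" by simp
    have cO: "continuous_on (Q i) (\<lambda>p. dflux (T (snd p)) (x i (fst p)) (e i))"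
    proof (rule continuous_on_flux(2))
      show "(\<lambda>p. x i (fst p)) ` Q i \<subseteq> R"
        using x_ball \<delta>(2) by (fastforce simp: Q_def)
    qed (use TR in \<open>auto simp: Q_def intro!: cx cT2 continuous_intros\<close>)
    have "(\<lambda>p. if p \<in> Q i then dflux (T (snd p)) (x i (fst p)) (e i) $ i else 0) \<in> borel_measurable borel"
      by (intro borel_measurable_continuous_on_if Q continuous_on_const continuous_on_component cO)
    moreover have "sets (borel \<Otimes>\<^sub>M M) = sets (borel :: (real \<times> 'm) measure)"
      unfolding borel_prod[symmetric] by (rule sets_pair_measure_cong) (simp_all add: M)
    ultimately have g_meas: "(\<lambda>(q, W). g i q W) \<in> borel_measurable (borel \<Otimes>\<^sub>M M)"
      by (simp add: g_def case_prod_beta' cong: measurable_cong_sets)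
    have fluxd: "(collision_flux A s (T W) has_derivative dflux (T W) (x i q)) (at (x i q))"
      if "(q, W) \<in> Q i" for q W
      using that x_ball[of q i] \<delta>(2) by (intro flux_has_derivative) (auto simp: Q_def)
    \<comment> \<open>The basis vector has norm 1, so a component of the directional derivative is
      bounded by the operator norm.\<close>
    show ui_g: "uniformly_integrable M {-\<delta><..<\<delta>} (g i)"
    proof (rule uniformly_integrable_dominated[OF ui, where h = "x i"])
      show "x i q \<in> ball v \<rho>" if "q \<in> {-\<delta><..<\<delta>}" for q
        using x_ball[OF that] \<delta>(2) by blast
      show "g i q \<in> borel_measurable M" for q
        using measurable_compose[OF measurable_Pair1' g_meas, of q] by simp
      show "\<bar>g i q W\<bar> \<le> \<bar>onorm (frechet_derivative (collision_flux A s (T W)) (at (x i q)))\<bar>" for q W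
      proof (cases "(q, W) \<in> Q i")
        case True
        have "\<bar>g i q W\<bar> \<le> norm (dflux (T W) (x i q) (e i))"
          using True by (simp add: g_def component_le_norm_cart)
        also have "\<dots> \<le> onorm (dflux (T W) (x i q)) * norm (e i)"
          by (intro onorm has_derivative_bounded_linear[OF fluxd[OF True]])
        also have "\<dots> = onorm (frechet_derivative (collision_flux A s (T W)) (at (x i q)))"
          by (simp add: e_def frechet_derivative_at[OF fluxd[OF True], symmetric])
        finally show ?thesis by simp
      qed (simp add: g_def)
    qed
    \<comment> \<open>\<open>N\<close> contains the whole axis line, so one null set of labels
      accounts for the collisions at all offsets.\<close>
    obtain N where N: "N \<in> null_sets lborel" "\<And>q. x i q \<in> N"
      using negligible_axis_line[OF dim, of v i] unfolding x_def e_def by blast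
    show "((\<lambda>q. \<integral>W. collision_flux A s (T W) (x i q) $ i \<partial>M) has_real_derivative
      (\<integral>W. g i 0 W \<partial>M)) (at 0)"
    proof (rule has_real_derivative_integral_uniformly_integrable[OF \<delta>(1) g_meas ui_g])
      show "integrable M (\<lambda>W. collision_flux A s (T W) (x i q) $ i)" if "q \<in> {-\<delta><..<\<delta>}" for q
        using x_ball[OF that] \<delta>(2)
        by (intro integrable_bounded_linear[OF bounded_linear_vec_nth] int) blast
      show "AE W in M. \<forall>q\<in>{-\<delta><..<\<delta>}.
          ((\<lambda>q. collision_flux A s (T W) (x i q) $ i) has_real_derivative g i q W) (at q)
          \<and> isCont (\<lambda>q. g i q W) q"
        using null[OF N(1)]
      proof eventually_elim
        case (elim W)
        then have WO: "(q, W) \<in> Q i" if "q \<in> {-\<delta><..<\<delta>}" for q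
          using that N(2)[of q] by (auto simp: Q_def)
        have "continuous_on {-\<delta><..<\<delta>} (\<lambda>q. dflux (T W) (x i q) (e i) $ i)"
          using WO by (intro continuous_on_component continuous_on_compose2[OF cO, of _ "\<lambda>q. (q, W)", simplified])
            (auto intro!: continuous_intros)
        then have cg: "continuous_on {-\<delta><..<\<delta>} (\<lambda>q. g i q W)"
          by (rule continuous_on_eq) (use WO in \<open>simp add: g_def\<close>)
        show ?case
        proof (intro ballI conjI)
          fix q assume q: "q \<in> {-\<delta><..<\<delta>}"
          show "isCont (\<lambda>q. g i q W) q"
            using cg q by (simp add: continuous_on_eq_continuous_at)
          have "(x i has_derivative (\<lambda>h. h *\<^sub>R e i)) (at q)"
            unfolding x_def by (auto intro!: derivative_eq_intros)
          from has_derivative_compose[OF this fluxd[OF WO[OF q]]]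
          have "((\<lambda>q. collision_flux A s (T W) (x i q) $ i) has_derivative
              (\<lambda>h. dflux (T W) (x i q) (h *\<^sub>R e i) $ i)) (at q)"
            by (rule bounded_linear.has_derivative[OF bounded_linear_vec_nth])
          moreover have "dflux (T W) (x i q) (h *\<^sub>R e i) $ i = g i q W * h" for h
            using WO[OF q] linear_scale[OF has_derivative_linear[OF fluxd[OF WO[OF q]]]]
            by (simp add: g_def)
          ultimately show "((\<lambda>q. collision_flux A s (T W) (x i q) $ i) has_real_derivative g i q W) (at q)"
            by (simp add: has_field_derivative_def)
        qed
      qed
    qed
  qed
  \<comment> \<open>Both sides are the derivative of \<open>u (x i q) $ i\<close> at
    \<open>q = 0\<close>, once by the chain rule and once under the integral.\<close>
  have "L (e i) $ i = (\<integral>W. g i 0 W \<partial>M)" for i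
  proof (rule DERIV_unique)
    have "(x i has_derivative (\<lambda>h. h *\<^sub>R e i)) (at 0)" "x i 0 = v"
      unfolding x_def by (auto intro!: derivative_eq_intros)
    with has_derivative_compose[of "x i" _ 0 UNIV u L] L
    have "((\<lambda>q. u (x i q)) has_derivative (\<lambda>h. L (h *\<^sub>R e i))) (at 0)" by simp
    then have "((\<lambda>q. u (x i q) $ i) has_derivative (\<lambda>h. L (h *\<^sub>R e i) $ i)) (at 0)"
      by (rule bounded_linear.has_derivative[OF bounded_linear_vec_nth])
    then show "((\<lambda>q. u (x i q) $ i) has_real_derivative L (e i) $ i) (at 0)"
      unfolding has_field_derivative_def
      by (rule has_derivative_eq_rhs) (simp add: linear_scale[OF has_derivative_linear[OF L]] fun_eq_iff)
    show "((\<lambda>q. u (x i q) $ i) has_real_derivative (\<integral>W. g i 0 W \<partial>M)) (at 0)"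
    proof (rule has_field_derivative_transform_within_open[OF deriv, of "{-\<delta><..<\<delta>}"])
      fix q assume q: "q \<in> {-\<delta><..<\<delta>}"
      then have "x i q \<in> R" using x_ball \<delta>(2) by blast
      then show "(\<integral>W. collision_flux A s (T W) (x i q) $ i \<partial>M) = u (x i q) $ i"
        by (simp add: u integral_bounded_linear[OF bounded_linear_vec_nth int])
    qed (use \<delta> in auto)
  qed
  then have "trace (matrix L) = (\<Sum>i\<in>UNIV. \<integral>W. g i 0 W \<partial>M)"
    by (simp add: trace_def matrix_def e_def)
  also have "\<dots> = (\<integral>W. (\<Sum>i\<in>UNIV. g i 0 W) \<partial>M)"
    using \<delta>(1) by (intro Bochner_Integration.integral_sum[symmetric] uniformly_integrable_integrable[OF ui_g]) auto
  also have "\<dots> = (\<integral>W. divergence (collision_flux A s (T W)) v \<partial>M)"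
  proof (rule integral_cong_AE)
    \<comment> \<open>Labels that flow to \<open>v\<close> itself form a null set; for all others
      the terms at \<open>q = 0\<close> are the diagonal entries of the flux derivative.\<close>
    have "AE W in M. T W \<notin> {v}" by (intro null countable_imp_null_set_lborel) simp
    then show "AE W in M. (\<Sum>i\<in>UNIV. g i 0 W) = divergence (collision_flux A s (T W)) v"
    proof eventually_elim
      case (elim W)
      with \<delta>(1) show ?case
        using divergence_eq_sum[OF flux_has_derivative[OF v, of "T W"]]
        by (auto simp: g_def Q_def x_def e_def)
    qed
    show "(\<lambda>W. \<Sum>i\<in>UNIV. g i 0 W) \<in> borel_measurable M"
      using ui_g \<delta>(1) by (intro borel_measurable_sum) (auto simp: uniformly_integrable_def)
  qed (rule borel_measurable_divergence_flux[OF M cT TR v])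
  finally show ?thesis .
qed

end

section \<open>Evolution of the log determinant along the flow\<close>

text \<open>The image law has a density, hence is absolutely continuous, and its almost-everywhere
  statements pull back to \<open>M\<close>.\<close>

lemma AE_notin_null_set_of_distr_density:
  assumes distr: "distr M borel T = density lborel f" and f: "f \<in> borel_measurable borel"
    and T: "T \<in> M \<rightarrow>\<^sub>M borel" and N: "N \<in> null_sets lborel"
  shows "AE x in M. T x \<notin> N"
proof -
  have "AE v in lborel. v \<notin> N" by (rule AE_not_in[OF N])
  then have "AE v in distr M borel T. v \<notin> N"
    unfolding distr using f by (subst AE_density) (auto elim: eventually_mono)
  then show ?thesis by (rule AE_distrD[OF T])
qed

text \<open>Uniform integrability is a condition that singular kernels allow: for the radial kernel
  and a locally Lipschitz score, the derivative of the flux near the diagonal is of order at most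
  \<open>\<gamma> + 2\<close> in the relative speed. This exponent is at least \<open>1 - d\<close>,
  so the bound is locally integrable, though unbounded for \<open>\<gamma> < -2\<close>.\<close>

theorem proposition4p1:
  fixes A :: "real ^ 'n \<Rightarrow> real ^ 'n ^ 'n"
    and f0 :: "real ^ 'n \<Rightarrow> real"
    and T :: "real ^ 'n \<Rightarrow> real \<Rightarrow> real ^ 'n"
    and ft :: "real \<Rightarrow> real ^ 'n \<Rightarrow> real"
    and s :: "real \<Rightarrow> real ^ 'n \<Rightarrow> real ^ 'n"
    and \<tau> t :: real
    and V :: "real ^ 'n"
  assumes dim: "CARD('n) \<ge> 2"
    and A_smooth: "C1_on (- {0}) A"
    and f0_density: "\<And>v. 0 \<le> f0 v" "integrable lborel f0" "(\<integral>v. f0 v \<partial>lborel) = 1"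
    and horizon: "0 < \<tau>"
    and flow_regular: "regular_flow \<tau> T"
    and flow_init: "\<And>W. T W 0 = W"
    and flow_integrable: "\<And>r W. r \<in> {0..\<tau>} \<Longrightarrow>
          integrable lborel (\<lambda>W'. f0 W' *\<^sub>R collision_flux A (s r) (T W' r) (T W r))"
    and flow_ode: "\<And>r W. r \<in> {0..\<tau>} \<Longrightarrow>
          (T W has_vector_derivative
             - (\<integral>W'. f0 W' *\<^sub>R collision_flux A (s r) (T W' r) (T W r) \<partial>lborel))
          (at r within {0..\<tau>})"
    and ft_density: "\<And>r v. r \<in> {0..\<tau>} \<Longrightarrow> 0 \<le> ft r v"
          "\<And>r. r \<in> {0..\<tau>} \<Longrightarrow> ft r \<in> borel_measurable borel"
    and ft_pushforward: "\<And>r. r \<in> {0..\<tau>} \<Longrightarrow>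
          distr (density lborel (\<lambda>W. ennreal (f0 W))) borel (\<lambda>W. T W r)
            = density lborel (\<lambda>v. ennreal (ft r v))"
    and ft_regular: "\<And>r v. r \<in> {0..\<tau>} \<Longrightarrow> v \<in> range (\<lambda>W. T W r) \<Longrightarrow>
          0 < ft r v \<and> ft r differentiable (at v)"
    and s_def: "\<And>r. s r = score (ft r)"
    and t: "t \<in> {0..\<tau>}"
    and s_smooth: "C1_on (range (\<lambda>W. T W t)) (s t)"
    and flux_uniformly_integrable: "\<And>W. \<exists>\<rho>>0.
          uniformly_integrable (density lborel (\<lambda>W'. ennreal (f0 W'))) (ball (T W t) \<rho>)
            (\<lambda>v W'. onorm (frechet_derivative (collision_flux A (s t) (T W' t)) (at v)))"
    and invertible: "\<And>W. det (jacobian (\<lambda>W'. T W' t) (at W)) \<noteq> 0"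
  shows "((\<lambda>r. ln \<bar>det (jacobian (\<lambda>W. T W r) (at V))\<bar>) has_real_derivative
            - (\<integral>W. divergence (collision_flux A (s t) (T W t)) (T V t) * f0 W \<partial>lborel))
          (at t within {0..\<tau>})
       \<and> (\<forall>C \<gamma>. 0 < C \<longrightarrow> - real CARD('n) - 1 \<le> \<gamma> \<longrightarrow> \<gamma> \<le> 1 \<longrightarrow>
            (\<forall>z. z \<noteq> 0 \<longrightarrow> A z = (C * norm z powr (\<gamma> + 2)) *\<^sub>R perp_proj z) \<longrightarrow>
            ((\<lambda>r. ln \<bar>det (jacobian (\<lambda>W. T W r) (at V))\<bar>) has_real_derivative
               - C * (\<integral>W. norm (T V t - T W t) powr (\<gamma> + 2)
                          * divergence (collision_flux perp_proj (s t) (T W t)) (T V t)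
                          * f0 W \<partial>lborel))
            (at t within {0..\<tau>}))"
proof -
  obtain A' where A': "\<And>z. z \<noteq> 0 \<Longrightarrow> (A has_derivative blinfun_apply (A' z)) (at z)"
      "continuous_on (- {0}) A'"
    using A_smooth unfolding C1_on_def by auto
  define S where "S W = T W t" for W
  define R where "R = range S"
  obtain s' where s': "\<And>x. x \<in> R \<Longrightarrow> (s t has_derivative blinfun_apply (s' x)) (at x)"
      "continuous_on R s'"
    using s_smooth unfolding C1_on_def R_def S_def by auto
  define F where "F r W = - (\<integral>W'. f0 W' *\<^sub>R collision_flux A (s r) (T W' r) (T W r) \<partial>lborel)" for r W
  have ode: "(T W has_vector_derivative F r W) (at r within {0..\<tau>})" if "r \<in> {0..\<tau>}" for r W
    unfolding F_def by (rule flow_ode[OF that])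
  obtain D E where
    D: "\<And>r W. r \<in> {0..\<tau>} \<Longrightarrow> (F r has_derivative blinfun_apply (D r W)) (at W)"
    and E: "\<And>r W. r \<in> {0..\<tau>} \<Longrightarrow> ((\<lambda>W. T W r) has_derivative blinfun_apply (E r W)) (at W)"
      "\<And>r. r \<in> {0..\<tau>} \<Longrightarrow> continuous_on UNIV (E r)"
      "\<And>r W. r \<in> {0..\<tau>} \<Longrightarrow> ((\<lambda>r. E r W) has_vector_derivative D r W) (at r within {0..\<tau>})"
    using regular_flow_spatial_derivative[OF flow_regular horizon flow_init ode] by blast
  have S: "\<And>W. (S has_derivative blinfun_apply (E t W)) (at W)"
    and nz: "\<And>W. det (jacobian S (at W)) \<noteq> 0"
    using E(1)[OF t] invertible by (simp_all add: S_def[abs_def])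
  have cS: "continuous_on UNIV S"
    using S by (meson continuous_at_imp_continuous_on has_derivative_continuous)
  then have S_meas: "S \<in> borel_measurable borel" by (rule borel_measurable_continuous_onI)
  interpret C1_collision A A' "s t" s' R
  proof
    show "open R" unfolding R_def by (rule open_range_C1_nonsingular[OF S E(2)[OF t] nz])
  qed (use A' s' in auto)
  have SR: "S W \<in> R" for W by (simp add: R_def)
  \<comment> \<open>\<open>M\<close> is the initial law of a particle; integrals weighted by
    \<open>f0\<close> become integrals over a finite measure.\<close>
  define M where "M = density lborel (\<lambda>W. ennreal (f0 W))"
  have f0_meas[measurable]: "f0 \<in> borel_measurable borel"
    using f0_density(2) by (simp add: borel_measurable_integrable)
  have sets_M: "sets M = sets borel" by (simp add: M_def)
  have "emeasure M (space M) = 1"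
    using f0_density by (simp add: M_def emeasure_density nn_integral_eq_integral)
  then have finM: "finite_measure M" by (intro finite_measureI) simp
  have null: "AE W in M. S W \<notin> N" if "N \<in> null_sets lborel" for N
  proof (rule AE_notin_null_set_of_distr_density[OF _ _ _ that])
    show "distr M borel S = density lborel (\<lambda>v. ennreal (ft t v))"
      using ft_pushforward[OF t] by (simp add: M_def S_def[abs_def])
  qed (use ft_density(2)[OF t] S_meas in \<open>simp_all add: M_def\<close>)
  have flux_meas: "(\<lambda>W. collision_flux A (s t) (S W) x) \<in> borel_measurable lborel" if "x \<in> R" for x
    using borel_measurable_flux[OF _ cS SR that, of lborel] by simp
  have div_meas[measurable]: "(\<lambda>W. divergence (collision_flux A (s t) (S W)) (S V)) \<in> borel_measurable lborel"
    using borel_measurable_divergence_flux[OF _ cS SR SR, of lborel] by simp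
  have int: "integrable M (\<lambda>W. collision_flux A (s t) (S W) x)" if "x \<in> R" for x
  proof -
    obtain W where "x = S W" using \<open>x \<in> R\<close> by (auto simp: R_def)
    then show ?thesis
      using flow_integrable[OF t, of W] flux_meas[OF that] f0_density(1)
      by (simp add: M_def integrable_density S_def)
  qed
  \<comment> \<open>The velocity field is \<open>- u\<close>: along the flow it reproduces the
    right-hand side of the equation at time \<open>t\<close>.\<close>
  define u where "u x = (\<integral>W. collision_flux A (s t) (S W) x \<partial>M)" for x
  have uS: "- u (S W) = F t W" for W
    using flux_meas[OF SR] f0_density(1) by (simp add: u_def M_def integral_density S_def F_def)
  \<comment> \<open>\<open>L\<close> is the spatial gradient of the velocity field; the second
    relation is the linearised flow equation that Jacobi's formula takes as input.\<close>
  obtain L where L: "((\<lambda>x. - u x) has_derivative L) (at (S V))" "blinfun_apply (D t V) = L \<circ> blinfun_apply (E t V)"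
    by (rule has_derivative_factor[where u = "\<lambda>x. - u x", OF S E(2)[OF t] nz uS D[OF t]])
  have "(u has_derivative (\<lambda>h. - L h)) (at (S V))"
    using has_derivative_minus[OF L(1)] by simp
  moreover obtain \<rho> where "0 < \<rho>" "uniformly_integrable M (ball (S V) \<rho>)
      (\<lambda>x W. onorm (frechet_derivative (collision_flux A (s t) (S W)) (at x)))"
    using flux_uniformly_integrable[of V] unfolding M_def S_def by blast
  ultimately have "trace (matrix (\<lambda>h. - L h)) = (\<integral>W. divergence (collision_flux A (s t) (S W)) (S V) \<partial>M)"
    by (intro trace_derivative_integral_flux[OF dim finM sets_M cS SR SR null int u_def])
  also have "\<dots> = (\<integral>W. divergence (collision_flux A (s t) (S W)) (S V) * f0 W \<partial>lborel)"
    using f0_density(1) by (simp add: M_def integral_density mult.commute)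
  finally have trace_L: "trace (matrix L) = - (\<integral>W. divergence (collision_flux A (s t) (S W)) (S V) * f0 W \<partial>lborel)"
    by (simp add: trace_def matrix_def sum_negf)
  \<comment> \<open>The identification with \<open>E\<close> is restricted to times in
    \<open>{0..\<tau>}\<close>, which is enough for a derivative within this interval.\<close>
  have jac: "jacobian (\<lambda>W. T W r) (at V) = matrix (blinfun_apply (E r V))" if "r \<in> {0..\<tau>}" for r
    using frechet_derivative_at[OF E(1)[OF that]] by (simp add: jacobian_def)
  have "((\<lambda>r. ln \<bar>det (matrix (blinfun_apply (E r V)))\<bar>) has_real_derivative trace (matrix L)) (at t within {0..\<tau>})"
  proof (rule has_real_derivative_ln_abs_det)
    fix i j :: 'n
    have "bounded_linear (\<lambda>B :: (real ^ 'n) \<Rightarrow>\<^sub>L (real ^ 'n). blinfun_apply B (axis j 1) $ i)"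
      by (intro bounded_linear_compose[OF bounded_linear_vec_nth] blinfun.bounded_linear_left)
    from bounded_linear.has_vector_derivative[OF this E(3)[OF t]]
    have "((\<lambda>r. E r V (axis j 1) $ i) has_real_derivative D t V (axis j 1) $ i) (at t within {0..\<tau>})"
      by (simp add: has_real_derivative_iff_has_vector_derivative)
    moreover have "matrix (blinfun_apply (D t V)) = matrix L ** matrix (blinfun_apply (E t V))"
      unfolding L(2) by (intro matrix_compose has_derivative_linear[OF L(1)] has_derivative_linear[OF S])
    then have "(matrix L ** matrix (blinfun_apply (E t V))) $ i $ j = D t V (axis j 1) $ i"
      by (metis (no_types) matrix_def vec_lambda_beta)
    ultimately show "((\<lambda>r. matrix (blinfun_apply (E r V)) $ i $ j) has_real_derivative
        (matrix L ** matrix (blinfun_apply (E t V))) $ i $ j) (at t within {0..\<tau>})"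
      by (simp add: matrix_def)
  next
    show "det (matrix (blinfun_apply (E t V))) \<noteq> 0"
      using invertible[of V] by (simp add: jac[OF t])
  qed
  then have general: "((\<lambda>r. ln \<bar>det (jacobian (\<lambda>W. T W r) (at V))\<bar>) has_real_derivative
      - (\<integral>W. divergence (collision_flux A (s t) (T W t)) (T V t) * f0 W \<partial>lborel)) (at t within {0..\<tau>})"
    unfolding trace_L S_def
    by (rule has_field_derivative_transform_within[OF _ zero_less_one t]) (simp add: jac)
  have special: "(\<integral>W. divergence (collision_flux A (s t) (S W)) (S V) * f0 W \<partial>lborel)
      = C * (\<integral>W. norm (S V - S W) powr (\<gamma> + 2)
          * divergence (collision_flux perp_proj (s t) (S W)) (S V) * f0 W \<partial>lborel)"
    if A_eq: "\<And>z. z \<noteq> 0 \<Longrightarrow> A z = (C * norm z powr (\<gamma> + 2)) *\<^sub>R perp_proj z" for C \<gamma>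
  proof -
    define k where "k W = C * (norm (S V - S W) powr (\<gamma> + 2)
        * divergence (collision_flux perp_proj (s t) (S W)) (S V) * f0 W)" for W
    \<comment> \<open>For \<open>S W = S V\<close> the factor \<open>0 powr (\<gamma> + 2)\<close>
      is 0 whatever the exponent, so \<open>k\<close> vanishes there. The equation also reduces
      measurability of \<open>k\<close> to that of the divergence with kernel
      \<open>A\<close>.\<close>
    have k_eq: "k W = (if S W \<noteq> S V then divergence (collision_flux A (s t) (S W)) (S V) * f0 W else 0)" for W
      using divergence_collision_flux_radial[OF A_eq, of "S V" "S W" "s t"]
        differentiableI[OF s'(1)[OF SR[of V]]]
      by (auto simp: k_def)
    have [measurable]: "S \<in> borel_measurable lborel" using S_meas by simp
    have "(\<integral>W. divergence (collision_flux A (s t) (S W)) (S V) * f0 W \<partial>lborel) = (\<integral>W. k W \<partial>lborel)"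
    proof (rule integral_cong_AE)
      \<comment> \<open>\<open>null\<close> speaks of \<open>M\<close>, hence only of labels with
        \<open>0 < f0 W\<close>; for the others both integrands carry the factor
        \<open>f0 W = 0\<close>.\<close>
      have "AE W in density lborel (\<lambda>W. ennreal (f0 W)). S W \<noteq> S V"
        unfolding M_def[symmetric]
        using null[of "{S V}"] countable_imp_null_set_lborel[of "{S V}"] by simp
      then have "AE W in lborel. 0 < f0 W \<longrightarrow> S W \<noteq> S V"
        by (subst (asm) AE_density) simp_all
      then show "AE W in lborel. divergence (collision_flux A (s t) (S W)) (S V) * f0 W = k W"
        by eventually_elim (use f0_density(1) in \<open>auto simp: k_eq less_le\<close>)
    qed (unfold k_eq, measurable)
    then show ?thesis by (simp add: k_def)
  qed
  show ?thesis
  proof (intro conjI allI impI)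
    fix C \<gamma> assume "\<forall>z. z \<noteq> 0 \<longrightarrow> A z = (C * norm z powr (\<gamma> + 2)) *\<^sub>R perp_proj z"
    then have "\<And>z. z \<noteq> 0 \<Longrightarrow> A z = (C * norm z powr (\<gamma> + 2)) *\<^sub>R perp_proj z" by blast
    from special[unfolded S_def, OF this]
    show "((\<lambda>r. ln \<bar>det (jacobian (\<lambda>W. T W r) (at V))\<bar>) has_real_derivative
        - C * (\<integral>W. norm (T V t - T W t) powr (\<gamma> + 2)
          * divergence (collision_flux perp_proj (s t) (T W t)) (T V t) * f0 W \<partial>lborel))
      (at t within {0..\<tau>})"
      by (intro DERIV_cong[OF general]) simp
  qed (fact general)
qed

end
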